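(* Let $s,t$ be integers with $s,t>1$ and $\gcd(s,t)=1$, and let $\omega_s=e^{2\pi I/s}$, $I=\sqrt{-1}$. Then for every $t$-core $\pi$, \[ \mathrm{GBG\text{-}rank}(\pi,s)=\frac{\sum_{i=0}^{t-1}\omega_s^{\,i+1}\bigl(\omega_s^{\,t\,n_i(\pi,t)}-1\bigr)}{(1-\omega_s)(1-\omega_s^{t})}. \]
   Context: For a partition $\pi$, its Young diagram has cells $(i,j)$ (row $i$, column $j$, $i,j\ge1$). For an integer $m\ge 1$ and $0\le k\le m-1$, $r_k(\pi,m)$ denotes the number of cells $(i,j)$ of the diagram of $\pi$ with $j-i\equiv k \pmod m$. The GBG-rank of $\pi$ mod $s$ is $\mathrm{GBG\text{-}rank}(\pi,s)=\sum_{k=0}^{s-1} r_k(\pi,s)\,\omega_s^{k}$. For $0\le i\le t-1$, $n_i(\pi,t)=r_i(\pi,t)-r_{i+1}(\pi,t)$, with indices taken mod $t$ (so $n_{t-1}(\pi,t)=r_{t-1}(\pi,t)-r_0(\pi,t)$). A rim cell of $\pi$ is a cell sharing a vertex or edge with the rim (boundary) of the diagram; a rim hook is a connected collection of rim cells whose removal leaves the diagram of a partition. $\pi$ is a $t$-core if its diagram has no rim hook of length $t$. *)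

theory Defs
  imports "HOL-Number_Theory.Cong" "HOL.Complex_Main"
begin

definition partition :: "nat list \<Rightarrow> bool" where
  "partition p \<longleftrightarrow> sorted_wrt (\<ge>) p \<and> (\<forall>x\<in>set p. x > 0)"

text \<open>Cells are pairs (row, column), numbered from 1.\<close>

definition diagram :: "nat list \<Rightarrow> (nat \<times> nat) set" where
  "diagram p = {(i, j). 1 \<le> i \<and> i \<le> length p \<and> 1 \<le> j \<and> j \<le> p ! (i - 1)}"

definition res_count :: "nat list \<Rightarrow> nat \<Rightarrow> nat \<Rightarrow> nat" where
  "res_count p m k = card {(i, j). (i, j) \<in> diagram p \<and> [int j - int i = int k] (mod int m)}"

definition omega :: "nat \<Rightarrow> complex" where
  "omega s = exp (2 * complex_of_real pi * \<i> / of_nat s)"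

definition GBG_rank :: "nat list \<Rightarrow> nat \<Rightarrow> complex" where
  "GBG_rank p s = (\<Sum>k<s. of_nat (res_count p s k) * omega s ^ k)"

definition n_coord :: "nat list \<Rightarrow> nat \<Rightarrow> nat \<Rightarrow> int" where
  "n_coord p t i = int (res_count p t i) - int (res_count p t ((i + 1) mod t))"

definition share_edge :: "nat \<times> nat \<Rightarrow> nat \<times> nat \<Rightarrow> bool" where
  "share_edge = (\<lambda>(i, j) (i', j').
     (i = i' \<and> (j' = j + 1 \<or> j = j' + 1)) \<or> (j = j' \<and> (i' = i + 1 \<or> i = i' + 1)))"

text \<open>Holds for every pair of cells whose closed unit squares meet, including equal cells.\<close>

definition share_vertex :: "nat \<times> nat \<Rightarrow> nat \<times> nat \<Rightarrow> bool" where
  "share_vertex = (\<lambda>(i, j) (i', j'). i \<le> i' + 1 \<and> i' \<le> i + 1 \<and> j \<le> j' + 1 \<and> j' \<le> j + 1)"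

text \<open>The rim is the boundary between the diagram and the rest of the quadrant
  of all cells with positive coordinates; the left and top sides of the
  quadrant are not part of it. So a cell of the diagram meets the rim in a vertex or an edge
  iff it meets some cell of the quadrant that lies outside the diagram.\<close>

definition rim_cells :: "nat list \<Rightarrow> (nat \<times> nat) set" where
  "rim_cells p = {c \<in> diagram p.
     \<exists>i j. i \<ge> 1 \<and> j \<ge> 1 \<and> (i, j) \<notin> diagram p \<and> share_vertex c (i, j)}"

definition connected_cells :: "(nat \<times> nat) set \<Rightarrow> bool" where
  "connected_cells H \<longleftrightarrow>
     (\<forall>c\<in>H. \<forall>d\<in>H. (c, d) \<in> {(x, y). x \<in> H \<and> y \<in> H \<and> share_edge x y}\<^sup>*)"

definition rim_hook :: "nat list \<Rightarrow> (nat \<times> nat) set \<Rightarrow> bool" where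
  "rim_hook p H \<longleftrightarrow> H \<noteq> {} \<and> H \<subseteq> rim_cells p \<and> connected_cells H \<and>
     (\<exists>q. partition q \<and> diagram q = diagram p - H)"

definition t_core :: "nat \<Rightarrow> nat list \<Rightarrow> bool" where
  "t_core t p \<longleftrightarrow> partition p \<and> \<not> (\<exists>H. rim_hook p H \<and> card H = t)"

end

theory Submission
  imports Defs
begin

text \<open>The contents \<open>j - i\<close> along a row telescope, so the GBG-rank and the numbers \<open>n_coord\<close> are both
  read off the set of beta numbers \<open>p\<^sub>i - i\<close>, compared with that of the empty partition.
  For a core this set is closed under subtracting \<open>t\<close>, hence on each residue class mod \<open>t\<close> it is an
  initial segment, whose length exceeds that of the empty partition by \<open>n_coord p t i\<close>. The
  rank is thereby a sum of \<open>t\<close> differences of geometric sums with ratio \<open>omega s ^ t\<close>.\<close>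

section \<open>Row lengths and beta numbers\<close>

definition row_len :: "nat list \<Rightarrow> nat \<Rightarrow> nat" where
  "row_len p i = (if 1 \<le> i \<and> i \<le> length p then p ! (i - 1) else 0)"

text \<open>The content of the last cell of row \<open>i\<close>. Empty rows count too, with value
  \<open>- int i\<close>, so there are infinitely many beta numbers.\<close>

definition beta :: "nat list \<Rightarrow> nat \<Rightarrow> int" where
  "beta p i = int (row_len p i) - int i"

lemma diagram_row_len: "diagram p = {(i, j). 1 \<le> i \<and> 1 \<le> j \<and> j \<le> row_len p i}"
  by (auto simp: diagram_def row_len_def split: if_splits)

lemma row_len_antimono:
  assumes "partition p" "1 \<le> i" "i \<le> j"
  shows "row_len p j \<le> row_len p i"
proof (cases "j \<le> length p \<and> i \<noteq> j")
  case True
  then have "i - 1 < j - 1" "j - 1 < length p" using assms by auto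
  then show ?thesis
    using assms True by (simp add: row_len_def partition_def sorted_wrt_iff_nth_less)
qed (auto simp: row_len_def)

lemma beta_strict_antimono:
  assumes "partition p" "1 \<le> i" "i < j"
  shows "beta p j < beta p i"
  using row_len_antimono[of p i j] assms by (simp add: beta_def)

lemma beta_inj_on: "partition p \<Longrightarrow> inj_on (beta p) {1..n}"
  by (rule inj_onI) (metis atLeastAtMost_iff beta_strict_antimono less_irrefl linorder_neqE_nat)

lemma beta_beyond_length: "length p < i \<Longrightarrow> beta p i = - int i"
  by (simp add: beta_def row_len_def)

section \<open>Removing a rim hook\<close>

text \<open>Supplies the partition left after a hook is removed. Parts must be positive, so the
  induction lowers the bound until \<open>f\<close> is nonzero there; by monotonicity all earlier
  values are then positive as well.\<close>

lemma exists_partition_of_row_lengths: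
  fixes f :: "nat \<Rightarrow> nat"
  assumes "\<And>i j. 1 \<le> i \<Longrightarrow> i \<le> j \<Longrightarrow> f j \<le> f i" and "\<And>i. n < i \<Longrightarrow> f i = 0"
  shows "\<exists>q. partition q \<and> diagram q = {(i, j). 1 \<le> i \<and> 1 \<le> j \<and> j \<le> f i}"
  using assms(2)
proof (induction n)
  case 0
  then have "diagram [] = {(i, j). 1 \<le> i \<and> 1 \<le> j \<and> j \<le> f i}"
    by (auto simp: diagram_def)
  then show ?case by (intro exI[of _ "[]"]) (simp add: partition_def)
next
  case (Suc n)
  show ?case
  proof (cases "f (Suc n) = 0")
    case True
    then have "\<And>i. n < i \<Longrightarrow> f i = 0" using Suc.prems by (metis Suc_lessI)
    then show ?thesis by (rule Suc.IH)
  next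
    case False
    define q where "q = map (\<lambda>i. f (Suc i)) [0..<Suc n]"
    have len: "length q = Suc n" by (simp add: q_def)
    have nth: "q ! i = f (Suc i)" if "i < Suc n" for i
      unfolding q_def using that by (subst nth_map) (simp_all del: upt_Suc)
    have "f (Suc n) \<le> f (Suc i)" if "i < Suc n" for i using that assms(1) by simp
    with False have pos: "0 < f (Suc i)" if "i < Suc n" for i
      using that by (metis gr0I le_zero_eq)
    have "partition q"
      unfolding partition_def sorted_wrt_iff_nth_less
      using pos assms(1) by (auto simp: len nth in_set_conv_nth)
    moreover have "row_len q i = f i" if "1 \<le> i" for i
      using that Suc.prems[of i] by (auto simp: row_len_def len nth)
    then have "diagram q = {(i, j). 1 \<le> i \<and> 1 \<le> j \<and> j \<le> f i}"
      by (auto simp: diagram_row_len)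
    ultimately show ?thesis by blast
  qed
qed

text \<open>If \<open>beta p i - t\<close> were not a beta number, replacing \<open>beta p i\<close> by it and sorting would
  remove a hook of length \<open>t\<close>: the new number moves down to row \<open>k\<close>, each row between \<open>i\<close> and
  \<open>k\<close> takes over the length of the next row minus one, and \<open>l\<close> is the new length of row \<open>k\<close>.\<close>

lemma t_core_beta_closed:
  assumes core: "t_core t p" and t: "0 < t" and i: "1 \<le> i"
  shows "\<exists>m\<ge>1. beta p m = beta p i - int t"
proof (rule ccontr)
  assume none: "\<not> ?thesis"
  define x where "x = beta p i - int t"
  have part: "partition p" using core by (simp add: t_core_def)
  have x_ne: "beta p m \<noteq> x" if "1 \<le> m" for m using none that by (auto simp: x_def)
  define N where "N = length p"
  \<comment> \<open>Every integer below \<open>- int N\<close> is the beta number of an empty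
    row.\<close>
  have x_ge: "- int N \<le> x"
  proof (rule ccontr)
    assume "\<not> - int N \<le> x"
    then have "beta p (nat (- x)) = x" "1 \<le> nat (- x)"
      by (auto simp: beta_beyond_length N_def)
    with x_ne show False by blast
  qed
  have iN: "i \<le> N"
  proof (rule ccontr)
    assume "\<not> i \<le> N"
    then show False using x_ge by (simp add: x_def beta_beyond_length N_def)
  qed
  \<comment> \<open>The last row whose beta number exceeds \<open>x\<close>, so that
    \<open>x\<close> lies strictly between the beta numbers of rows \<open>Suc k\<close> and
    \<open>k\<close>.\<close>
  define k where "k = Max {m \<in> {i..N}. x < beta p m}"
  have fin: "finite {m \<in> {i..N}. x < beta p m}" by simp
  have "i \<in> {m \<in> {i..N}. x < beta p m}" using iN t by (simp add: x_def)
  then have "k \<in> {m \<in> {i..N}. x < beta p m}"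
    unfolding k_def by (intro Max_in fin) blast
  then have ik: "i \<le> k" and kN: "k \<le> N" and kx: "x < beta p k" by auto
  have k1x: "beta p (Suc k) < x"
  proof (cases "Suc k \<le> N")
    case True
    have "\<not> x < beta p (Suc k)"
    proof
      assume "x < beta p (Suc k)"
      then have "Suc k \<in> {m \<in> {i..N}. x < beta p m}" using True ik by auto
      then have "Suc k \<le> k" unfolding k_def by (rule Max_ge[OF fin])
      then show False by simp
    qed
    with x_ne[of "Suc k"] show ?thesis by simp
  next
    case False
    then show ?thesis using x_ge kN by (simp add: beta_beyond_length N_def)
  qed
  define P where "P = row_len p"
  have anti: "P b \<le> P a" if "1 \<le> a" "a \<le> b" for a b
    using row_len_antimono[OF part that] by (simp add: P_def)
  define l where "l = nat (x + int k)"
  have l_int: "int l = x + int k"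
    using k1x kx by (simp add: l_def beta_def)
  have lP: "l < P k" and Pl: "P (Suc k) \<le> l"
    using kx k1x l_int by (auto simp: beta_def P_def)
  \<comment> \<open>The first column removed from row \<open>j\<close>; the new row length is
    \<open>L j - 1\<close>, which is no truncated subtraction because of
    \<open>L_pos\<close>.\<close>
  define L where "L j = (if j < k then P (Suc j) else Suc l)" for j
  have L_pos: "1 \<le> L j" if "j \<le> k" for j
  proof (cases "j < k")
    case True
    then have "P k \<le> P (Suc j)" by (intro anti) auto
    with True lP show ?thesis by (simp add: L_def)
  qed (simp add: L_def)
  have L_le: "L j \<le> P j" if "1 \<le> j" "j \<le> k" for j
    using that lP anti[of j "Suc j"] by (cases "j < k") (auto simp: L_def)
  have L_ge: "P (Suc j) \<le> L j" if "j \<le> k" for j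
    using that Pl by (cases "j < k") (auto simp: L_def)
  define f where "f j = (if i \<le> j \<and> j \<le> k then L j - 1 else P j)" for j
  define H where "H = (SIGMA j:{i..k}. {L j..P j})"
  have "\<exists>q. partition q \<and> diagram q = {(a, b). 1 \<le> a \<and> 1 \<le> b \<and> b \<le> f a}"
  proof (rule exists_partition_of_row_lengths)
    fix a b :: nat assume ab: "1 \<le> a" "a \<le> b"
    have f_Suc: "f (Suc c) \<le> f c" if c: "1 \<le> c" for c
    proof -
      have "P (Suc c) \<le> P c" using anti c by simp
      moreover have "L (Suc c) \<le> P (Suc c)" if "c < k" using L_le that by simp
      moreover have "L c = P (Suc c)" if "c < k" using that by (simp add: L_def)
      moreover have "L c = Suc l" if "c = k" using that by (simp add: L_def)
      ultimately show ?thesis using ik Pl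
        by (cases c k rule: linorder_cases) (auto simp: f_def)
    qed
    from ab(2) show "f b \<le> f a"
    proof (induction rule: dec_induct)
      case (step n)
      then show ?case using f_Suc[of n] ab by simp
    qed simp
  next
    fix a assume "N < a"
    then show "f a = 0" using kN by (simp add: f_def P_def row_len_def N_def)
  qed
  then obtain q where q: "partition q" "diagram q = {(a, b). 1 \<le> a \<and> 1 \<le> b \<and> b \<le> f a}"
    by blast
  have f_iff: "b \<le> f a \<longleftrightarrow> b \<le> P a \<and> (a, b) \<notin> H" if "1 \<le> a" "1 \<le> b" for a b
  proof (cases "a \<in> {i..k}")
    case True
    then show ?thesis using L_pos[of a] L_le[of a] that by (auto simp: f_def H_def)
  qed (auto simp: f_def H_def)
  have diff: "diagram q = diagram p - H"
    unfolding q(2) diagram_row_len[of p] using f_iff by (auto simp: P_def)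
  have rim: "H \<subseteq> rim_cells p"
  proof
    fix c assume "c \<in> H"
    then obtain a b where c: "c = (a, b)" and ab: "i \<le> a" "a \<le> k" "L a \<le> b" "b \<le> P a"
      by (auto simp: H_def)
    have "(a, b) \<in> diagram p"
      using ab L_pos[of a] i by (auto simp: diagram_row_len P_def)
    \<comment> \<open>The diagonal neighbour to the lower right witnesses that the cell meets the
      rim.\<close>
    moreover have "(Suc a, Suc b) \<notin> diagram p"
      using L_ge[of a] ab by (auto simp: diagram_row_len P_def)
    moreover have "share_vertex (a, b) (Suc a, Suc b)" by (simp add: share_vertex_def)
    moreover have "1 \<le> Suc a" "1 \<le> Suc b" by simp_all
    ultimately show "c \<in> rim_cells p" unfolding c rim_cells_def by blast
  qed
  define R where "R = {(x, y). x \<in> H \<and> y \<in> H \<and> share_edge x y}"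
  have "sym R" by (auto simp: R_def sym_def share_edge_def)
  have along: "((a, b), (a, L a)) \<in> R\<^sup>*" if "a \<in> {i..k}" "L a \<le> b" "b \<le> P a" for a b
    using that(2,3)
  proof (induction b rule: dec_induct)
    case (step n)
    have "((a, Suc n), (a, n)) \<in> R"
      using step that(1) by (auto simp: R_def H_def share_edge_def)
    with step show ?case by (meson Suc_leD converse_rtrancl_into_rtrancl)
  qed simp
  \<comment> \<open>Since \<open>L n = P (Suc n)\<close>, the cell below the first hook cell of row
    \<open>n\<close> is the last cell of row \<open>Suc n\<close>. Walking left and then down leads
    every cell of \<open>H\<close> to the foot \<open>(k, L k)\<close>.\<close>
  have down: "((a, L a), (k, L k)) \<in> R\<^sup>*" if "i \<le> a" "a \<le> k" for a
    using that(2,1)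
  proof (induction a rule: inc_induct)
    case (step n)
    have La: "L n = P (Suc n)" using step by (simp add: L_def)
    have le: "L (Suc n) \<le> P (Suc n)" "L n \<le> P n" using L_le step i by auto
    have "((n, L n), (Suc n, L n)) \<in> R"
      using step le by (auto simp: R_def H_def share_edge_def La)
    moreover have "((Suc n, L n), (Suc n, L (Suc n))) \<in> R\<^sup>*"
      using along[of "Suc n" "L n"] step le by (auto simp: La)
    ultimately show ?case using step by (meson converse_rtrancl_into_rtrancl le_SucI rtrancl_trans)
  qed simp
  have to_end: "(c, (k, L k)) \<in> R\<^sup>*" if "c \<in> H" for c
    using that along down by (fastforce simp: H_def intro: rtrancl_trans)
  have conn: "connected_cells H"
    unfolding connected_cells_def R_def[symmetric]
    using to_end sym_rtrancl[OF \<open>sym R\<close>] by (meson rtrancl_trans symD)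
  \<comment> \<open>Row \<open>j < k\<close> contributes \<open>beta p j - beta p (Suc j)\<close>
    and row \<open>k\<close> contributes \<open>beta p k - x\<close>. The total telescopes to
    \<open>beta p i - x\<close>, which is \<open>t\<close>.\<close>
  have "int (card H) = (\<Sum>j\<in>{i..k}. int (card {L j..P j}))"
    by (simp add: H_def)
  also have "\<dots> = (\<Sum>j\<in>{i..k}. int (P j) + 1 - int (L j))"
  proof (rule sum.cong[OF refl])
    fix j assume "j \<in> {i..k}"
    then show "int (card {L j..P j}) = int (P j) + 1 - int (L j)"
      using L_le[of j] i by (simp add: of_nat_diff)
  qed
  also have "\<dots> = int (P k) - int l + (\<Sum>j\<in>{i..<k}. int (P j) + 1 - int (P (Suc j)))"
    using ik by (simp add: atLeastLessThanSuc_atLeastAtMost[symmetric] L_def del: of_nat_Suc)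
  also have "(\<Sum>j\<in>{i..<k}. int (P j) + 1 - int (P (Suc j))) = (\<Sum>j\<in>{i..<k}. beta p j - beta p (Suc j))"
    by (simp add: beta_def P_def algebra_simps)
  also have "\<dots> = beta p i - beta p k"
    using sum_Suc_diff'[OF ik, of "\<lambda>j. - beta p j"] by simp
  also have "int (P k) - int l + \<dots> = int t"
    using l_int by (simp add: x_def beta_def P_def)
  finally have card: "card H = t" by simp
  then have "H \<noteq> {}" using t by auto
  with rim conn q(1) diff have "rim_hook p H" by (auto simp: rim_hook_def)
  with card core show False by (auto simp: t_core_def)
qed

section \<open>Telescoping sums over the diagram\<close>

text \<open>The contents of row \<open>i\<close> run from \<open>1 - i\<close> to
  \<open>beta p i\<close>, so each row collapses to two terms, the second being that of the empty
  partition. Empty rows up to \<open>N\<close> contribute zero.\<close>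

lemma sum_diagram_telescope:
  fixes f :: "int \<Rightarrow> 'a::ab_group_add"
  assumes "length p \<le> N"
  shows "(\<Sum>(i, j)\<in>diagram p. f (int j - int i) - f (int j - int i - 1))
    = (\<Sum>i\<in>{1..N}. f (beta p i)) - (\<Sum>i\<in>{1..N}. f (- int i))"
proof -
  have "diagram p = (SIGMA i:{1..N}. {1..row_len p i})"
    using assms by (auto simp: diagram_row_len row_len_def split: if_splits)
  then have "(\<Sum>(i, j)\<in>diagram p. f (int j - int i) - f (int j - int i - 1))
      = (\<Sum>i\<in>{1..N}. \<Sum>j\<in>{1..row_len p i}. f (int j - int i) - f (int j - int i - 1))"
    by (simp add: sum.Sigma)
  also have "\<dots> = (\<Sum>i\<in>{1..N}. f (beta p i) - f (- int i))"
  proof (rule sum.cong[OF refl])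
    fix i
    have "(\<Sum>j\<in>{1..n}. f (int j - int i) - f (int j - int i - 1)) = f (int n - int i) - f (- int i)" for n
      by (induction n) (simp_all add: algebra_simps)
    then show "(\<Sum>j\<in>{1..row_len p i}. f (int j - int i) - f (int j - int i - 1)) = f (beta p i) - f (- int i)"
      by (simp add: beta_def)
  qed
  finally show ?thesis by (simp add: sum_subtractf)
qed

lemma finite_diagram: "finite (diagram p)"
proof (rule finite_subset)
  show "diagram p \<subseteq> (SIGMA i:{1..length p}. {1..p ! (i - 1)})" by (auto simp: diagram_def)
qed simp

section \<open>The abacus of a core\<close>

text \<open>Runner \<open>r\<close> carries \<open>a r\<close> consecutive beads, the lowest at \<open>r - t * N\<close>. Only the first
  \<open>t * N\<close> beta numbers are kept: dropping the rest cuts every runner at the same level.\<close>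

definition abacus :: "nat \<Rightarrow> nat \<Rightarrow> (nat \<Rightarrow> nat) \<Rightarrow> int set" where
  "abacus t N a = (\<lambda>(r, m). int r + int t * (int m - int N)) ` (SIGMA r:{..<t}. {..<a r})"

lemma abacus_position_inj:
  assumes "r < t" "r' < t" "int r + int t * x = int r' + int t * y"
  shows "r = r' \<and> x = y"
proof -
  have "(int r + int t * x) mod int t = int r" using assms(1) by simp
  moreover have "(int r' + int t * y) mod int t = int r'" using assms(2) by simp
  ultimately have "r = r'" using assms(3) by (metis of_nat_eq_iff)
  with assms show ?thesis by simp
qed

lemma sum_abacus:
  "sum f (abacus t N a) = (\<Sum>r<t. \<Sum>m<a r. f (int r + int t * (int m - int N)))"
proof -
  have "inj_on (\<lambda>(r, m). int r + int t * (int m - int N)) (SIGMA r:{..<t}. {..<a r})"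
  proof (rule inj_onI)
    fix x y :: "nat \<times> nat"
    assume "x \<in> (SIGMA r:{..<t}. {..<a r})" "y \<in> (SIGMA r:{..<t}. {..<a r})"
      and eq: "(case x of (r, m) \<Rightarrow> int r + int t * (int m - int N))
        = (case y of (r, m) \<Rightarrow> int r + int t * (int m - int N))"
    then have "fst x < t" "fst y < t" by auto
    moreover have "int (fst x) + int t * (int (snd x) - int N) = int (fst y) + int t * (int (snd y) - int N)"
      using eq by (simp only: case_prod_unfold)
    ultimately have "fst x = fst y \<and> int (snd x) - int N = int (snd y) - int N"
      by (rule abacus_position_inj)
    then show "x = y" by (simp add: prod_eq_iff)
  qed
  then have "sum f (abacus t N a)
      = (\<Sum>(r, m)\<in>(SIGMA r:{..<t}. {..<a r}). f (int r + int t * (int m - int N)))"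
    unfolding abacus_def by (subst sum.reindex) (simp_all only: o_def case_prod_unfold)
  also have "\<dots> = (\<Sum>r<t. \<Sum>m<a r. f (int r + int t * (int m - int N)))"
    by (rule sum.Sigma[symmetric]) simp_all
  finally show ?thesis .
qed

lemma finite_down_closed_eq_lessThan:
  fixes A :: "nat set"
  assumes "finite A" and "\<And>m. Suc m \<in> A \<Longrightarrow> m \<in> A"
  shows "\<exists>n. A = {..<n}"
proof -
  have down: "m \<in> A" if "n \<in> A" "m \<le> n" for m n
    using that(2,1) by (induction rule: inc_induct) (auto intro: assms(2))
  define n where "n = (LEAST n. n \<notin> A)"
  have "\<exists>n. n \<notin> A" using assms(1) ex_new_if_finite infinite_UNIV_nat by blast
  then have "n \<notin> A" unfolding n_def by (rule LeastI_ex)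
  then have "A = {..<n}"
    using down not_less_Least[of _ "\<lambda>n. n \<notin> A"] unfolding n_def[symmetric]
    by (auto simp: not_less[symmetric])
  then show ?thesis by blast
qed

lemma neg_le_div:
  assumes "0 < t" and "- int (t * N) \<le> b"
  shows "- int N \<le> b div int t"
proof -
  have "- int N = (int t * (- int N)) div int t"
    using assms(1) by (intro nonzero_mult_div_cancel_left[symmetric]) simp
  also have "\<dots> \<le> b div int t"
    using assms by (intro zdiv_mono1) auto
  finally show ?thesis .
qed

text \<open>On runner \<open>r\<close>, subtracting \<open>t\<close> lowers the level
  \<open>m\<close> by one, so the occupied levels form a finite set closed under predecessors, hence
  an initial segment. The lower bound on \<open>B\<close> makes all levels natural numbers.\<close>

lemma closed_set_eq_abacus:
  assumes t: "0 < t" and "finite B" and low: "\<And>b. b \<in> B \<Longrightarrow> - int (t * N) \<le> b"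
    and closed: "\<And>b. b \<in> B \<Longrightarrow> - int (t * N) \<le> b - int t \<Longrightarrow> b - int t \<in> B"
  shows "\<exists>a. B = abacus t N a"
proof -
  define A where "A r = {m. int r + int t * (int m - int N) \<in> B}" for r
  have "\<exists>n. A r = {..<n}" for r
  proof (rule finite_down_closed_eq_lessThan)
    have "inj (\<lambda>m. int r + int t * (int m - int N))" using t by (auto simp: inj_def)
    then show "finite (A r)" unfolding A_def
      using finite_vimageI[OF \<open>finite B\<close>] by (simp add: vimage_def)
  next
    fix m assume "Suc m \<in> A r"
    then show "m \<in> A r"
      using closed[of "int r + int t * (int (Suc m) - int N)"] by (simp add: A_def algebra_simps)
  qed
  then obtain a where a: "\<And>r. A r = {..<a r}" by metis
  have "B = abacus t N a"
  proof (intro set_eqI iffI)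
    fix b assume b: "b \<in> B"
    define r where "r = nat (b mod int t)"
    define m where "m = nat (b div int t + int N)"
    have "- int N \<le> b div int t"
      using t low[OF b] by (rule neg_le_div)
    then have b_eq: "b = int r + int t * (int m - int N)" and "r < t"
      using t by (auto simp: r_def m_def nat_less_iff)
    with b have "m \<in> A r" by (simp add: A_def)
    with a \<open>r < t\<close> b_eq show "b \<in> abacus t N a" by (auto simp: abacus_def intro!: rev_image_eqI[of "(r, m)"])
  next
    fix b assume "b \<in> abacus t N a"
    then show "b \<in> B" using a by (auto simp: abacus_def A_def)
  qed
  then show ?thesis by blast
qed

lemma t_core_beta_eq_abacus:
  assumes core: "t_core t p" and t: "0 < t" and N: "length p \<le> t * N"
  shows "\<exists>a. beta p ` {1..t * N} = abacus t N a"
proof (rule closed_set_eq_abacus[OF t])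
  fix b assume b: "b \<in> beta p ` {1..t * N}"
  then show "- int (t * N) \<le> b" by (auto simp: beta_def simp del: of_nat_mult)
  assume ge: "- int (t * N) \<le> b - int t"
  from b obtain i where "b = beta p i" "1 \<le> i" by auto
  then obtain m where m: "1 \<le> m" "beta p m = b - int t"
    using t_core_beta_closed[OF core t] by blast
  \<comment> \<open>The truncation loses nothing here: rows beyond \<open>t * N\<close> are empty
    and their beta numbers lie below the cutoff.\<close>
  have "m \<le> t * N"
  proof (rule ccontr)
    assume "\<not> m \<le> t * N"
    then have "beta p m = - int m" "int (t * N) < int m"
      using N by (simp_all add: beta_beyond_length del: of_nat_mult)
    then show False using m ge by linarith
  qed
  with m show "b - int t \<in> beta p ` {1..t * N}" by (auto intro!: image_eqI[of _ _ m])
qed simp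

text \<open>The truncated beta numbers of the empty partition. As their number is a multiple of
  \<open>t\<close>, they fill each runner with exactly \<open>N\<close> beads.\<close>

lemma negatives_eq_abacus:
  assumes "0 < t"
  shows "(\<lambda>i. - int i) ` {1..t * N} = abacus t N (\<lambda>_. N)"
proof (intro set_eqI iffI)
  fix b assume "b \<in> (\<lambda>i. - int i) ` {1..t * N}"
  then have b: "- int (t * N) \<le> b" "b < 0" by (auto simp del: of_nat_mult)
  define r where "r = nat (b mod int t)"
  define m where "m = nat (b div int t + int N)"
  have "- int N \<le> b div int t"
    using assms b(1) by (rule neg_le_div)
  moreover have "b div int t < 0" using b assms by (simp add: pos_imp_zdiv_neg_iff)
  ultimately have "b = int r + int t * (int m - int N)" "r < t" "m < N"
    using assms by (auto simp: r_def m_def nat_less_iff)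
  then show "b \<in> abacus t N (\<lambda>_. N)" by (auto simp: abacus_def intro!: rev_image_eqI[of "(r, m)"])
next
  fix b assume "b \<in> abacus t N (\<lambda>_. N)"
  then obtain r m where b: "b = int r + int t * (int m - int N)" and "r < t" "m < N"
    by (auto simp: abacus_def)
  have "int t * (int m - int N) \<le> int t * (- 1)"
    using \<open>m < N\<close> by (intro mult_left_mono) auto
  moreover have "int t * (- int N) \<le> int t * (int m - int N)"
    by (intro mult_left_mono) auto
  ultimately have "b < 0" "- int (t * N) \<le> b" using b \<open>r < t\<close> by auto
  then show "b \<in> (\<lambda>i. - int i) ` {1..t * N}" by (intro image_eqI[of _ _ "nat (- b)"]) (auto simp: nat_le_iff)
qed

text \<open>One choice of \<open>N\<close> and \<open>a\<close> serves all \<open>f\<close>. This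
  links the rank to the numbers \<open>n_coord\<close>: the former comes from powers of
  \<open>omega s\<close>, the latter from indicators of residue classes.\<close>

lemma t_core_sum_diagram:
  assumes core: "t_core t p" and t: "0 < t"
  obtains N a where
    "\<And>f :: int \<Rightarrow> complex. (\<Sum>(i, j)\<in>diagram p. f (int j - int i) - f (int j - int i - 1))
      = (\<Sum>r<t. (\<Sum>m<a r. f (int r + int t * (int m - int N)))
                - (\<Sum>m<N. f (int r + int t * (int m - int N))))"
proof -
  define N where "N = length p"
  have N: "length p \<le> t * N" using t by (simp add: N_def)
  obtain a where a: "beta p ` {1..t * N} = abacus t N a"
    using t_core_beta_eq_abacus[OF core t N] by blast
  have part: "partition p" using core by (simp add: t_core_def)
  have "(\<Sum>(i, j)\<in>diagram p. f (int j - int i) - f (int j - int i - 1))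
      = (\<Sum>r<t. (\<Sum>m<a r. f (int r + int t * (int m - int N)))
                - (\<Sum>m<N. f (int r + int t * (int m - int N))))" for f :: "int \<Rightarrow> complex"
  proof -
    have "(\<Sum>i\<in>{1..t * N}. f (beta p i)) = sum f (abacus t N a)"
      unfolding a[symmetric] sum.reindex[OF beta_inj_on[OF part]] o_def ..
    moreover have "(\<Sum>i\<in>{1..t * N}. f (- int i)) = sum f (abacus t N (\<lambda>_. N))"
      by (subst negatives_eq_abacus[OF t, symmetric], subst sum.reindex) (auto simp: inj_on_def)
    ultimately show ?thesis
      by (simp add: sum_diagram_telescope[OF N] sum_abacus sum_subtractf)
  qed
  then show thesis by (rule that)
qed

section \<open>Residue counts and rank as sums over cells\<close>

lemma res_count_eq_sum:
  "of_nat (res_count p m k) = (\<Sum>(i, j)\<in>diagram p. of_bool ([int j - int i = int k] (mod int m)) :: complex)"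
proof -
  have "{(i, j). (i, j) \<in> diagram p \<and> [int j - int i = int k] (mod int m)}
      = diagram p \<inter> {c. [int (snd c) - int (fst c) = int k] (mod int m)}"
    by auto
  then show ?thesis
    by (simp add: res_count_def of_bool_def sum.If_cases finite_diagram case_prod_unfold)
qed

text \<open>A content is congruent to \<open>k + 1\<close> iff its predecessor is congruent to
  \<open>k\<close>, also at the wrap-around \<open>k = t - 1\<close>. This gives the telescoping
  form, with \<open>f\<close> the indicator of the class of \<open>k\<close>.\<close>

lemma n_coord_eq_sum:
  "of_int (n_coord p t k) = (\<Sum>(i, j)\<in>diagram p.
     of_bool ([int j - int i = int k] (mod int t)) - of_bool ([int j - int i - 1 = int k] (mod int t)) :: complex)"
proof -
  have "[c = int ((k + 1) mod t)] (mod int t) \<longleftrightarrow> [c - 1 = int k] (mod int t)" for c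
    using cong_add_rcancel[of "c - 1" 1 "int k" "int t"]
    by (simp add: cong_def of_nat_mod add.commute)
  then show ?thesis
    by (simp add: n_coord_def res_count_eq_sum sum_subtractf case_prod_unfold)
qed

lemma omega_power_self: "0 < s \<Longrightarrow> omega s ^ s = 1"
  by (simp add: omega_def exp_of_nat_mult[symmetric])

text \<open>\<open>omega s\<close> is a primitive root of unity: the exponent may be reduced mod
  \<open>s\<close>, and the powers with exponents below \<open>s\<close> are distinct.\<close>

lemma omega_power_eq_1_imp_dvd:
  assumes "0 < s" and "omega s ^ n = 1"
  shows "s dvd n"
proof -
  have cis: "omega s ^ k = cis (2 * pi * real k / real s)" for k
  proof -
    have "omega s = cis (2 * pi / real s)" by (simp add: omega_def cis_conv_exp mult_ac)
    then show ?thesis by (simp only: DeMoivre) (simp add: mult_ac)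
  qed
  have "omega s ^ n = omega s ^ (s * (n div s) + n mod s)" by simp
  also have "\<dots> = omega s ^ (n mod s)"
    using assms(1) by (simp only: power_add power_mult omega_power_self) simp
  finally have "omega s ^ (n mod s) = omega s ^ 0" using assms(2) by simp
  then have "cis (2 * pi * real (n mod s) / real s) = cis (2 * pi * real 0 / real s)"
    unfolding cis .
  moreover have "inj_on (\<lambda>k. cis (2 * pi * real k / real s)) {..<s}"
    using bij_betw_roots_unity[OF assms(1)] by (rule bij_betw_imp_inj_on)
  ultimately have "n mod s = 0"
    using assms(1) by (elim inj_onD) auto
  then show ?thesis by auto
qed

text \<open>As \<open>omega s ^ s = 1\<close>, a power depends only on its exponent mod
  \<open>s\<close>, so each cell may carry its content itself as exponent. Contents may be negative,
  hence \<open>powi\<close>.\<close>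

lemma GBG_rank_eq_sum:
  assumes "0 < s"
  shows "GBG_rank p s = (\<Sum>(i, j)\<in>diagram p. omega s powi (int j - int i))"
proof -
  have nz: "omega s \<noteq> 0" by (simp add: omega_def)
  have per: "omega s powi c = omega s ^ nat (c mod int s)" for c
  proof -
    have "omega s powi c = omega s powi (int s * (c div int s) + c mod int s)" by simp
    also have "\<dots> = omega s powi (c mod int s)"
      using omega_power_self[OF assms] by (simp only: power_int_add[OF disjI1[OF nz]] power_int_mult) simp
    finally show ?thesis using assms by (simp add: power_int_def)
  qed
  have "GBG_rank p s = (\<Sum>(i, j)\<in>diagram p. \<Sum>k<s.
      of_bool ([int j - int i = int k] (mod int s)) * omega s ^ k)"
    unfolding GBG_rank_def res_count_eq_sum sum_distrib_right case_prod_unfold by (rule sum.swap)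
  also have "\<dots> = (\<Sum>(i, j)\<in>diagram p. omega s powi (int j - int i))"
  proof (intro sum.cong refl, clarify)
    fix i j :: nat
    let ?c = "int j - int i"
    have "[?c = int k] (mod int s) \<longleftrightarrow> k = nat (?c mod int s)" if "k < s" for k
      using that assms by (auto simp: cong_def)
    then have "(\<Sum>k<s. of_bool ([?c = int k] (mod int s)) * omega s ^ k)
        = (\<Sum>k<s. if k = nat (?c mod int s) then omega s ^ k else 0)"
      by (intro sum.cong) auto
    also have "\<dots> = omega s powi ?c"
      using assms by (simp add: per nat_less_iff)
    finally show "(\<Sum>k<s. of_bool ([?c = int k] (mod int s)) * omega s ^ k) = omega s powi ?c" .
  qed
  finally show ?thesis .
qed

section \<open>Evaluating the rank on the runners\<close>

theorem theorem1p1: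
  fixes s t :: nat and p :: "nat list"
  assumes "s > 1" and "t > 1" and "coprime s t" and "t_core t p"
  shows "GBG_rank p s =
    (\<Sum>i<t. omega s ^ (i + 1) * (omega s powi (int t * n_coord p t i) - 1))
      / ((1 - omega s) * (1 - omega s ^ t))"
proof -
  define w where "w = omega s"
  have t: "0 < t" using assms by simp
  have nz: "w \<noteq> 0" by (simp add: w_def omega_def)
  have w1: "w \<noteq> 1" using omega_power_eq_1_imp_dvd[of s 1] assms(1) by (auto simp add: w_def)
  \<comment> \<open>Coprimality enters here: it makes the second factor of the denominator
    nonzero.\<close>
  have "\<not> s dvd t" using assms(1,3) by (metis coprime_absorb_left less_irrefl nat_dvd_1_iff_1)
  then have wt: "w ^ t \<noteq> 1" using omega_power_eq_1_imp_dvd[of s t] assms(1) by (auto simp add: w_def)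
  obtain N a where Na:
    "\<And>f :: int \<Rightarrow> complex. (\<Sum>(i, j)\<in>diagram p. f (int j - int i) - f (int j - int i - 1))
      = (\<Sum>r<t. (\<Sum>m<a r. f (int r + int t * (int m - int N)))
                - (\<Sum>m<N. f (int r + int t * (int m - int N))))"
    using t_core_sum_diagram[OF assms(4) t] by blast
  \<comment> \<open>With the indicator of the class of \<open>k\<close> as \<open>f\<close>, each
    bead on runner \<open>k\<close> counts once and all others vanish.\<close>
  have n: "n_coord p t k = int (a k) - int N" if "k < t" for k
  proof -
    have hit: "[int r + int t * c = int k] (mod int t) \<longleftrightarrow> r = k" if "r < t" for r c
      using that \<open>k < t\<close> by (simp add: cong_def)
    have "complex_of_int (n_coord p t k) = (\<Sum>r<t. (\<Sum>m<a r. of_bool (r = k)) - (\<Sum>m<N. of_bool (r = k)))"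
      unfolding n_coord_eq_sum Na[of "\<lambda>c. of_bool ([c = int k] (mod int t))"]
      by (intro sum.cong) (simp_all add: hit)
    also have "\<dots> = (\<Sum>r<t. if r = k then of_nat (a r) - of_nat N else 0)"
      by (intro sum.cong) auto
    also have "\<dots> = of_int (int (a k) - int N)"
      using that by simp
    finally show ?thesis unfolding of_int_eq_iff .
  qed
  \<comment> \<open>The beads of runner \<open>r\<close> start at \<open>r - t * N\<close> and are
    \<open>t\<close> apart, so the ratio is \<open>w ^ t\<close>.\<close>
  have geo: "(\<Sum>m<n. w powi (int r + int t * (int m - int N) + 1))
      = w powi (int r + 1 - int t * int N) * ((w ^ t) ^ n - 1) / (w ^ t - 1)" for n r
  proof -
    have "w powi (int r + int t * (int m - int N) + 1) = w powi (int r + 1 - int t * int N) * (w ^ t) ^ m" for m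
    proof -
      have "int r + int t * (int m - int N) + 1 = (int r + 1 - int t * int N) + int (t * m)"
        by (simp add: algebra_simps)
      then show ?thesis by (simp only: power_int_add[OF disjI1[OF nz]] power_int_of_nat power_mult)
    qed
    then show ?thesis using geometric_sum[OF wt] by (simp add: sum_distrib_left[symmetric])
  qed
  \<comment> \<open>The factor \<open>w - 1\<close> turns each power into a difference of
    consecutive powers. The unreduced \<open>- 1 + 1\<close> matches \<open>Na\<close> for
    \<open>f c = w powi (c + 1)\<close>.\<close>
  have "GBG_rank p s * (w - 1) = (\<Sum>(i, j)\<in>diagram p. w powi (int j - int i + 1) - w powi (int j - int i - 1 + 1))"
  proof -
    have "w powi c * (w - 1) = w powi (c + 1) - w powi (c - 1 + 1)" for c
      using nz by (simp add: power_int_add right_diff_distrib)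
    then show ?thesis
      using assms(1) by (simp add: GBG_rank_eq_sum w_def sum_distrib_right case_prod_unfold)
  qed
  also have "\<dots> = (\<Sum>r<t. w ^ (r + 1) * (w powi (int t * n_coord p t r) - 1) / (w ^ t - 1))"
    unfolding Na[of "\<lambda>c. w powi (c + 1)"]
  proof (intro sum.cong refl)
    fix r assume "r \<in> {..<t}"
    then have r: "n_coord p t r = int (a r) - int N" using n by simp
    \<comment> \<open>The lower ends of the two geometric sums cancel. What remains are the
      exponents one period above the top beads: \<open>r + 1\<close> for the empty partition, and
      \<open>r + 1\<close> plus \<open>t\<close> times \<open>n_coord p t r\<close> for
      \<open>p\<close>.\<close>
    have 1: "w powi (int r + 1 - int t * int N) * (w ^ t) ^ N = w ^ (r + 1)"
    proof -
      have "w powi (int r + 1 - int t * int N) * w powi int (t * N) = w powi int (r + 1)"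
        using nz by (simp add: power_int_add[symmetric] add.commute)
      then show ?thesis by (simp only: power_int_of_nat power_mult)
    qed
    have 2: "w powi (int r + 1 - int t * int N) * (w ^ t) ^ a r = w ^ (r + 1) * w powi (int t * n_coord p t r)"
    proof -
      have "w powi (int r + 1 - int t * int N) * w powi int (t * a r) = w powi int (r + 1) * w powi (int t * n_coord p t r)"
        by (simp only: power_int_add[OF disjI1[OF nz], symmetric] r) (simp add: algebra_simps)
      then show ?thesis by (simp only: power_int_of_nat power_mult)
    qed
    show "(\<Sum>m<a r. w powi (int r + int t * (int m - int N) + 1))
        - (\<Sum>m<N. w powi (int r + int t * (int m - int N) + 1))
        = w ^ (r + 1) * (w powi (int t * n_coord p t r) - 1) / (w ^ t - 1)"
      unfolding geo
      by (simp only: diff_divide_distrib[symmetric] right_diff_distrib mult_1_right 1 2) simp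
  qed
  finally have "GBG_rank p s * (w - 1) * (w ^ t - 1)
      = (\<Sum>r<t. w ^ (r + 1) * (w powi (int t * n_coord p t r) - 1))"
    using wt by (simp add: sum_divide_distrib[symmetric])
  moreover have "(w - 1) * (w ^ t - 1) = (1 - w) * (1 - w ^ t)" by (simp add: algebra_simps)
  ultimately show ?thesis using w1 wt unfolding w_def[symmetric]
    by (simp add: eq_divide_eq mult.assoc)
qed

end
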